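(* Let $G=\mathrm{GIRG}(n,\beta,w_0,d)$ be a standard GIRG with $\beta<3$. Then the clique number satisfies $\omega(G)=O(n^{(3-\beta)/2})$ asymptotically almost surely.
   Context: Fix constants $\lambda>0$, $w_0>0$, $\beta>2$. A standard GIRG $\mathrm{GIRG}(n,\beta,w_0,d)$ has $n$ vertices; each vertex $v$ independently receives a weight $w_v$ with $\Pr[w_v\le x]=1-(x/w_0)^{1-\beta}$ for $x\ge w_0$, and independently a position $\mathbf{x}_v$ uniform on the torus $\mathbb{T}^d=[0,1)^d$. The distance is $d(\mathbf{x}_u,\mathbf{x}_v)=\max_{1\le i\le d}|x_{ui}-x_{vi}|_C$ with $|a-b|_C=\min\{|a-b|,1-|a-b|\}$. Distinct $u,v$ are adjacent iff $d(\mathbf{x}_u,\mathbf{x}_v)\le \frac12\big(\frac{\lambda w_uw_v}{n}\big)^{1/d}$. The dimension $d=d(n)$ may depend on $n$. $\omega(G)$ is the size of the largest clique; "asymptotically almost surely" means with probability $1-o(1)$ as $n\to\infty$. *)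

theory Defs
  imports "HOL-Probability.Probability" "HOL-Library.Ramsey"
begin

definition weight_cdf :: "real \<Rightarrow> real \<Rightarrow> real \<Rightarrow> real" where
  "weight_cdf \<beta> w0 x = (if x < w0 then 0 else 1 - (x / w0) powr (1 - \<beta>))"

text \<open>The Lebesgue--Stieltjes measure of the distribution function, i.e. the law of a single weight
  (see \<open>cdf_weight_distribution\<close> below).\<close>

definition weight_distribution :: "real \<Rightarrow> real \<Rightarrow> real measure" where
  "weight_distribution \<beta> w0 = interval_measure (weight_cdf \<beta> w0)"

text \<open>Points of the torus are functions on the coordinate set \<open>{..<d}\<close>; the uniform law on
  \<open>[0,1)\<^sup>d\<close> is the \<open>d\<close>-fold product of the uniform law on \<open>[0,1)\<close>.\<close>

definition torus_uniform :: "nat \<Rightarrow> (nat \<Rightarrow> real) measure" where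
  "torus_uniform d = PiM {..<d} (\<lambda>_. uniform_measure lborel {0..<1})"

text \<open>Outcomes are pairs \<open>(w, x)\<close>, where \<open>w v\<close> is the weight of vertex \<open>v < n\<close> and \<open>x v\<close> its position.
  The product measure makes all weights and positions independent. The graph itself is a function of
  the outcome, see \<open>girg_edges\<close>.\<close>

definition girg_measure :: "nat \<Rightarrow> real \<Rightarrow> real \<Rightarrow> nat \<Rightarrow> ((nat \<Rightarrow> real) \<times> (nat \<Rightarrow> nat \<Rightarrow> real)) measure" where
  "girg_measure n \<beta> w0 d =
     PiM {..<n} (\<lambda>_. weight_distribution \<beta> w0) \<Otimes>\<^sub>M PiM {..<n} (\<lambda>_. torus_uniform d)"

definition circle_dist :: "real \<Rightarrow> real \<Rightarrow> real" where
  "circle_dist a b = min \<bar>a - b\<bar> (1 - \<bar>a - b\<bar>)"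

text \<open>Only meaningful for \<open>d \<ge> 1\<close>.\<close>

definition torus_dist :: "nat \<Rightarrow> (nat \<Rightarrow> real) \<Rightarrow> (nat \<Rightarrow> real) \<Rightarrow> real" where
  "torus_dist d x y = Max ((\<lambda>i. circle_dist (x i) (y i)) ` {..<d})"

definition girg_edges ::
    "real \<Rightarrow> nat \<Rightarrow> nat \<Rightarrow> (nat \<Rightarrow> real) \<times> (nat \<Rightarrow> nat \<Rightarrow> real) \<Rightarrow> nat set set" where
  "girg_edges lam n d = (\<lambda>(w, x).
     {{u, v} | u v. u < n \<and> v < n \<and> u \<noteq> v \<and>
        torus_dist d (x u) (x v) \<le> 1 / 2 * (lam * w u * w v / real n) powr (1 / real d)})"

definition clique_number :: "'a set \<Rightarrow> 'a set set \<Rightarrow> nat" where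
  "clique_number V E = Max {card K | K. K \<subseteq> V \<and> clique K E}"

lemma weight_cdf_eq:
  assumes "w0 > 0"
  shows "weight_cdf \<beta> w0 x = 1 - (max x w0 / w0) powr (1 - \<beta>)"
  using assms by (auto simp: weight_cdf_def max_def)

lemma weight_cdf_mono:
  assumes "w0 > 0" "\<beta> > 1" "x \<le> y"
  shows "weight_cdf \<beta> w0 x \<le> weight_cdf \<beta> w0 y"
  unfolding weight_cdf_eq[OF assms(1)] using assms
  by (intro diff_left_mono powr_mono2') (auto simp: divide_simps)

lemma weight_cdf_right_cont:
  assumes "w0 > 0"
  shows "continuous (at_right a) (weight_cdf \<beta> w0)"
proof -
  have "isCont (\<lambda>x. 1 - (max x w0 / w0) powr (1 - \<beta>)) a"
    using assms by (intro continuous_intros) auto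
  moreover have "weight_cdf \<beta> w0 = (\<lambda>x. 1 - (max x w0 / w0) powr (1 - \<beta>))"
    using weight_cdf_eq[OF assms] by blast
  ultimately show ?thesis
    by (simp add: continuous_at_imp_continuous_within)
qed

lemma weight_cdf_at_bot: "(weight_cdf \<beta> w0 \<longlongrightarrow> 0) at_bot"
proof (rule tendsto_eventually)
  show "\<forall>\<^sub>F x in at_bot. weight_cdf \<beta> w0 x = 0"
    using eventually_gt_at_bot[of w0] eventually_at_bot_dense[of "\<lambda>x. weight_cdf \<beta> w0 x = 0"]
    by (auto simp: weight_cdf_def)
qed

lemma weight_cdf_at_top:
  assumes "w0 > 0" "\<beta> > 1"
  shows "(weight_cdf \<beta> w0 \<longlongrightarrow> 1) at_top"
proof -
  have "filterlim (\<lambda>x. x / w0) at_top at_top"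
    unfolding filterlim_at_top
  proof
    fix Z
    show "\<forall>\<^sub>F x in at_top. Z \<le> x / w0"
      using eventually_ge_at_top[of "Z * w0"]
      by eventually_elim (use assms in \<open>simp add: field_simps\<close>)
  qed
  then have "((\<lambda>x. (x / w0) powr (1 - \<beta>)) \<longlongrightarrow> 0) at_top"
    using assms by (intro tendsto_neg_powr) auto
  then have "((\<lambda>x. 1 - (x / w0) powr (1 - \<beta>)) \<longlongrightarrow> 1 - 0) at_top"
    by (intro tendsto_intros)
  moreover have "\<forall>\<^sub>F x in at_top. 1 - (x / w0) powr (1 - \<beta>) = weight_cdf \<beta> w0 x"
    using eventually_ge_at_top[of w0] by eventually_elim (auto simp: weight_cdf_def)
  ultimately show ?thesis
    by (simp add: filterlim_cong[OF refl refl])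
qed

lemma real_distribution_weight_distribution:
  assumes "w0 > 0" "\<beta> > 1"
  shows "real_distribution (weight_distribution \<beta> w0)"
  unfolding weight_distribution_def
  using assms
  by (intro real_distribution_interval_measure weight_cdf_mono weight_cdf_right_cont
        weight_cdf_at_bot weight_cdf_at_top)

lemma cdf_weight_distribution:
  assumes "w0 > 0" "\<beta> > 1"
  shows "cdf (weight_distribution \<beta> w0) = weight_cdf \<beta> w0"
  unfolding weight_distribution_def
  using assms
  by (intro cdf_interval_measure weight_cdf_mono weight_cdf_right_cont weight_cdf_at_bot)

lemma prob_space_torus_uniform: "prob_space (torus_uniform d)"
  unfolding torus_uniform_def
  by (intro prob_space_PiM prob_space_uniform_measure) auto

lemma prob_space_girg_measure:
  assumes "w0 > 0" "\<beta> > 1"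
  shows "prob_space (girg_measure n \<beta> w0 d)"
proof -
  interpret W: prob_space "PiM {..<n} (\<lambda>_. weight_distribution \<beta> w0)"
    using real_distribution_weight_distribution[OF assms]
    by (intro prob_space_PiM) (simp add: real_distribution_def)
  interpret X: prob_space "PiM {..<n} (\<lambda>_. torus_uniform d)"
    by (intro prob_space_PiM prob_space_torus_uniform)
  interpret pair_prob_space "PiM {..<n} (\<lambda>_. weight_distribution \<beta> w0)"
      "PiM {..<n} (\<lambda>_. torus_uniform d)" ..
  show ?thesis
    unfolding girg_measure_def by (rule prob_space_axioms)
qed

end

theory Submission
  imports Defs "HOL-Real_Asymp.Real_Asymp"
begin

text \<open>In a clique with more than \<open>k\<close> vertices, a vertex \<open>u\<close> of minimal weight is adjacent to
  \<open>k\<close> vertices of at least its own weight. Given the weight and position of \<open>u\<close>, these \<open>k\<close>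
  adjacencies are independent. Two vertices of weights \<open>a\<close> and \<open>b\<close> are adjacent with probability
  at most \<open>min 1 (\<lambda> a b / n)\<close> in every dimension, so each of these events has probability
  \<open>q = O(n powr ((3 - \<beta>) / 2 - 1))\<close>, whatever the weight of \<open>u\<close>. A union bound over \<open>u\<close> and
  the \<open>k\<close> neighbours gives at most \<open>n (n choose k) q\<^sup>k \<le> n exp (e n q - k)\<close>, which tends to 0
  when \<open>k\<close> is a large enough multiple of \<open>n powr ((3 - \<beta>) / 2)\<close>.\<close>

section \<open>Distances, edges and the clique number as pointwise conditions\<close>

lemma circle_dist_commute: "circle_dist a b = circle_dist b a"
  by (simp add: circle_dist_def abs_minus_commute)

lemma torus_dist_commute: "torus_dist d x y = torus_dist d y x"
  by (simp add: torus_dist_def circle_dist_commute)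

lemma torus_dist_le_iff:
  assumes "d \<ge> 1"
  shows "torus_dist d x y \<le> r \<longleftrightarrow> (\<forall>i<d. circle_dist (x i) (y i) \<le> r)"
proof -
  have "{..<d} \<noteq> {}"
    using assms by (auto simp: lessThan_empty_iff)
  then show ?thesis
    unfolding torus_dist_def by (subst Max_le_iff) auto
qed

lemma doubleton_in_girg_edges_iff:
  "{u, v} \<in> girg_edges lam n d (w, x) \<longleftrightarrow>
     u < n \<and> v < n \<and> u \<noteq> v \<and>
     torus_dist d (x u) (x v) \<le> 1 / 2 * (lam * w u * w v / real n) powr (1 / real d)"
  unfolding girg_edges_def
  by (auto simp: doubleton_eq_iff torus_dist_commute mult_ac)

text \<open>The maximum ranges over a finite set that is nonempty because of the empty clique. The
  right-hand side is a finite conjunction of clique events, which is what makes the event of the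
  theorem measurable.\<close>

lemma clique_number_le_iff:
  assumes "finite V"
  shows "real (clique_number V E) \<le> c \<longleftrightarrow> (\<forall>K\<in>Pow V. clique K E \<longrightarrow> real (card K) \<le> c)"
proof -
  let ?A = "{card K | K. K \<subseteq> V \<and> clique K E}"
  have "?A \<subseteq> card ` Pow V"
    by auto
  then have fin: "finite ?A"
    using assms by (meson finite_Pow_iff finite_imageI finite_subset)
  have "card {} \<in> ?A"
    by (force simp: clique_def)
  then have ne: "?A \<noteq> {}"
    by blast
  have "real (Max ?A) \<le> c \<longleftrightarrow> (\<forall>a\<in>?A. real a \<le> c)"
  proof
    assume "real (Max ?A) \<le> c"
    then show "\<forall>a\<in>?A. real a \<le> c"
      using Max_ge[OF fin] by (meson of_nat_mono order_trans)
  next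
    assume "\<forall>a\<in>?A. real a \<le> c"
    then show "real (Max ?A) \<le> c"
      using Max_in[OF fin ne] by blast
  qed
  then show ?thesis
    unfolding clique_number_def by blast
qed

section \<open>Measurability of weights, positions and distances\<close>

lemma sets_weight_distribution [simp, measurable_cong]: "sets (weight_distribution \<beta> w0) = sets borel"
  by (simp add: weight_distribution_def)

lemma space_weight_distribution [simp]: "space (weight_distribution \<beta> w0) = UNIV"
  by (simp add: weight_distribution_def)

lemma sets_torus_uniform [measurable_cong]:
  "sets (torus_uniform d) = sets (PiM {..<d} (\<lambda>_. borel))"
  unfolding torus_uniform_def by (intro sets_PiM_cong) auto

lemma measurable_circle_dist [measurable]:
  assumes [measurable]: "f \<in> borel_measurable M" "g \<in> borel_measurable M"
  shows "(\<lambda>x. circle_dist (f x) (g x)) \<in> borel_measurable M"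
  unfolding circle_dist_def by measurable

lemma measurable_coordinate_torus_uniform:
  "i < d \<Longrightarrow> (\<lambda>x. x i) \<in> borel_measurable (torus_uniform d)"
  by (simp add: sets_torus_uniform cong: measurable_cong_sets)

lemma pred_torus_dist_le:
  assumes "d \<ge> 1" and [measurable]: "f \<in> measurable M (torus_uniform d)"
    "g \<in> measurable M (torus_uniform d)" "r \<in> borel_measurable M"
  shows "Measurable.pred M (\<lambda>x. torus_dist d (f x) (g x) \<le> r x)"
proof -
  have "(\<lambda>x. f x i) \<in> borel_measurable M" "(\<lambda>x. g x i) \<in> borel_measurable M" if "i < d" for i
    using that by (auto intro!: measurable_compose[OF _ measurable_coordinate_torus_uniform] assms)
  note [measurable] = this
  have "Measurable.pred M (\<lambda>x. \<forall>i\<in>{..<d}. circle_dist (f x i) (g x i) \<le> r x)"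
    by (intro pred_intros_finite) (simp, measurable)
  then show ?thesis
    unfolding torus_dist_le_iff[OF assms(1)] by (simp add: Ball_def)
qed

section \<open>Volume of balls in the torus\<close>

text \<open>For \<open>2 * r \<ge> 1\<close> the trivial bound 1 suffices. Otherwise the ball is an
  arc of length \<open>2 * r\<close>, which may wrap around the end of the unit interval.\<close>

lemma emeasure_circle_ball_le:
  assumes "0 \<le> a" "a < 1" "0 \<le> r"
  shows "emeasure (uniform_measure lborel {0..<1}) {b. circle_dist a b \<le> r} \<le> ennreal (2 * r)"
proof -
  let ?U = "uniform_measure lborel {0..<1::real}"
  interpret prob_space ?U
    by (rule prob_space_uniform_measure) auto
  show ?thesis
  proof (cases "2 * r \<ge> 1")
    case True
    have "emeasure ?U {b. circle_dist a b \<le> r} \<le> 1"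
      by (rule emeasure_le_1)
    also have "\<dots> \<le> ennreal (2 * r)"
      using True by (metis ennreal_1 ennreal_leI)
    finally show ?thesis .
  next
    case False
    \<comment> \<open>\<open>?A\<close> is the part of the arc that does not wrap; \<open>?B\<close>
      and \<open>?C\<close> are the parts wrapping past 0 and past 1. The \<open>max\<close> and
      \<open>min\<close> shrink a wrapped part to a single point when there is no wrapping, so all
      three intervals are nonempty and their lengths need no case split.\<close>
    let ?A = "{max 0 (a - r)..min 1 (a + r)}" and ?B = "{a + 1 - r..max 1 (a + 1 - r)}"
      and ?C = "{min 0 (a - 1 + r)..a - 1 + r}"
    have [measurable]: "{b. circle_dist a b \<le> r} \<in> sets borel"
      by measurable
    have "emeasure ?U {b. circle_dist a b \<le> r} = emeasure lborel ({0..<1} \<inter> {b. circle_dist a b \<le> r})"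
      by (simp add: divide_ennreal_def)
    also have "\<dots> \<le> emeasure lborel (?A \<union> (?B \<union> ?C))"
      using assms by (intro emeasure_mono) (auto simp: circle_dist_def min_def max_def abs_if split: if_splits)
    also have "\<dots> \<le> emeasure lborel ?A + (emeasure lborel ?B + emeasure lborel ?C)"
      by (intro order_trans[OF emeasure_subadditive] add_left_mono) auto
    also have "\<dots> = ennreal ((min 1 (a + r) - max 0 (a - r)) + ((max 1 (a + 1 - r) - (a + 1 - r))
        + (a - 1 + r - min 0 (a - 1 + r))))"
      using assms False by (simp add: ennreal_plus[symmetric] del: ennreal_plus)
    \<comment> \<open>Whatever \<open>?A\<close> loses at 0 or 1 reappears as the length of
      \<open>?B\<close> or \<open>?C\<close>.\<close>
    also have "\<dots> = ennreal (2 * r)"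
      using assms False by (intro arg_cong[where f = ennreal]) (auto simp: min_def max_def)
    finally show ?thesis .
  qed
qed

text \<open>The underlying space admits arbitrary real coordinates, whereas the ball estimates need
  a centre with coordinates in [0,1).\<close>

lemma AE_torus_uniform: "AE x in torus_uniform d. \<forall>i<d. 0 \<le> x i \<and> x i < 1"
proof -
  have "AE x in torus_uniform d. \<forall>i\<in>{..<d}. x i \<in> {0..<1}"
    unfolding torus_uniform_def
  proof (intro AE_finite_allI AE_PiM_component)
    show "AE x in uniform_measure lborel {0..<1::real}. x \<in> {0..<1}"
      by (rule AE_uniform_measureI) auto
  qed (auto intro: prob_space_uniform_measure)
  then show ?thesis
    by eventually_elim auto
qed

text \<open>A ball of the maximum distance is a product of \<open>d\<close> arcs, each of measure at
  most \<open>t powr (1 / real d)\<close>. The \<open>d\<close>-th power cancels the root, so the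
  bound does not depend on the dimension.\<close>

lemma emeasure_torus_ball_le:
  assumes "d \<ge> 1" and a: "\<And>i. i < d \<Longrightarrow> 0 \<le> a i \<and> a i < 1" and "t \<ge> 0"
  shows "emeasure (torus_uniform d) {b \<in> space (torus_uniform d).
           torus_dist d a b \<le> 1 / 2 * t powr (1 / real d)} \<le> ennreal (min 1 t)"
proof -
  let ?U = "uniform_measure lborel {0..<1::real}"
  let ?r = "1 / 2 * t powr (1 / real d)"
  interpret T: prob_space "torus_uniform d"
    by (rule prob_space_torus_uniform)
  interpret U: prob_space ?U
    by (rule prob_space_uniform_measure) auto
  interpret product_prob_space "\<lambda>_. ?U" "{..<d}"
    by unfold_locales
  let ?A = "{b \<in> space (torus_uniform d). torus_dist d a b \<le> ?r}"
  have "?A = PiE {..<d} (\<lambda>i. {b. circle_dist (a i) b \<le> ?r})"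
    unfolding torus_dist_le_iff[OF assms(1)]
    by (rule set_eqI) (simp add: torus_uniform_def space_PiM PiE_iff Ball_def conj_commute)
  moreover have "emeasure (torus_uniform d) (PiE {..<d} (\<lambda>i. {b. circle_dist (a i) b \<le> ?r})) =
      (\<Prod>i<d. emeasure ?U {b. circle_dist (a i) b \<le> ?r})"
    unfolding torus_uniform_def by (rule emeasure_PiM) (simp_all, measurable)
  ultimately have "emeasure (torus_uniform d) ?A = (\<Prod>i<d. emeasure ?U {b. circle_dist (a i) b \<le> ?r})"
    by (rule ssubst)
  also have "\<dots> \<le> (\<Prod>i<d. ennreal (2 * ?r))"
    using a by (intro prod_mono_ennreal emeasure_circle_ball_le) auto
  also have "\<dots> = ennreal ((t powr (1 / real d)) ^ d)"
    by (simp add: ennreal_power)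
  \<comment> \<open>The case \<open>t = 0\<close> is separate because turning a power into
    \<open>powr\<close> needs a positive base.\<close>
  also have "(t powr (1 / real d)) ^ d = t"
    using assms by (cases "t = 0") (auto simp: powr_realpow[symmetric] powr_powr)
  finally have "emeasure (torus_uniform d) ?A \<le> ennreal t" .
  then show ?thesis
    using T.emeasure_le_1[of ?A] by (auto simp: min_def)
qed

section \<open>Independence of the adjacencies of one vertex\<close>

text \<open>Conditioning on coordinate \<open>u\<close> makes the factors independent.\<close>

lemma nn_integral_PiM_star_le:
  fixes f :: "'i \<Rightarrow> 'a \<Rightarrow> 'a \<Rightarrow> ennreal"
  assumes M: "prob_space M" and I: "finite I" "u \<in> I" "S \<subseteq> I - {u}"
    and f [measurable]: "\<And>v. v \<in> S \<Longrightarrow> case_prod (f v) \<in> borel_measurable (M \<Otimes>\<^sub>M M)"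
    and le: "AE a in M. \<forall>v\<in>S. (\<integral>\<^sup>+b. f v a b \<partial>M) \<le> c v"
  shows "(\<integral>\<^sup>+x. (\<Prod>v\<in>S. f v (x u) (x v)) \<partial>PiM I (\<lambda>_. M)) \<le> (\<Prod>v\<in>S. c v)"
proof -
  interpret M: prob_space M by fact
  interpret product_prob_space "\<lambda>_. M" I
    by unfold_locales
  define J where "J = I - {u}"
  have J: "finite J" "u \<notin> J" "I = insert u J" "S \<subseteq> J"
    using I by (auto simp: J_def)
  have meas: "(\<lambda>x. \<Prod>v\<in>S. f v (x u) (x v)) \<in> borel_measurable (PiM I (\<lambda>_. M))"
  proof (intro borel_measurable_prod_ennreal)
    fix v assume v: "v \<in> S"
    then have "(\<lambda>x. (x u, x v)) \<in> measurable (PiM I (\<lambda>_. M)) (M \<Otimes>\<^sub>M M)"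
      using I by (intro measurable_Pair measurable_component_singleton) auto
    from measurable_compose[OF this f[OF v]]
    show "(\<lambda>x. f v (x u) (x v)) \<in> borel_measurable (PiM I (\<lambda>_. M))"
      by simp
  qed
  have inner: "(\<integral>\<^sup>+x. (\<Prod>v\<in>S. f v a (x v)) \<partial>PiM J (\<lambda>_. M)) = (\<Prod>v\<in>S. \<integral>\<^sup>+b. f v a b \<partial>M)"
    if a: "a \<in> space M" for a
  proof -
    have fa: "f v a \<in> borel_measurable M" if "v \<in> S" for v
      using measurable_compose[OF measurable_Pair1'[OF a] f[OF that]] by simp
    \<comment> \<open>Padding with the constant 1 outside \<open>S\<close> gives a product over all
      of \<open>J\<close>, as Fubini for finite products requires; each padding factor integrates to
      1.\<close>
    have "(\<integral>\<^sup>+x. (\<Prod>v\<in>S. f v a (x v)) \<partial>PiM J (\<lambda>_. M)) =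
        (\<integral>\<^sup>+x. (\<Prod>v\<in>J. (if v \<in> S then f v a else (\<lambda>_. 1)) (x v)) \<partial>PiM J (\<lambda>_. M))"
      using J by (intro nn_integral_cong prod.mono_neutral_cong_left) auto
    also have "\<dots> = (\<Prod>v\<in>J. \<integral>\<^sup>+b. (if v \<in> S then f v a else (\<lambda>_. 1)) b \<partial>M)"
      using J fa by (intro product_nn_integral_prod) auto
    also have "\<dots> = (\<Prod>v\<in>S. \<integral>\<^sup>+b. f v a b \<partial>M)"
      using J by (intro prod.mono_neutral_cong_right) (auto simp: M.emeasure_space_1)
    finally show ?thesis .
  qed
  have "(\<integral>\<^sup>+x. (\<Prod>v\<in>S. f v (x u) (x v)) \<partial>PiM I (\<lambda>_. M)) =
      (\<integral>\<^sup>+a. (\<integral>\<^sup>+x. (\<Prod>v\<in>S. f v ((x(u := a)) u) ((x(u := a)) v)) \<partial>PiM J (\<lambda>_. M)) \<partial>M)"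
    unfolding J(3) by (rule product_nn_integral_insert_rev) (use J meas in auto)
  also have "\<dots> = (\<integral>\<^sup>+a. (\<Prod>v\<in>S. \<integral>\<^sup>+b. f v a b \<partial>M) \<partial>M)"
  proof (rule nn_integral_cong)
    fix a assume a: "a \<in> space M"
    have "(\<Prod>v\<in>S. f v ((x(u := a)) u) ((x(u := a)) v)) = (\<Prod>v\<in>S. f v a (x v))" for x
      using J by (intro prod.cong) auto
    then show "(\<integral>\<^sup>+x. (\<Prod>v\<in>S. f v ((x(u := a)) u) ((x(u := a)) v)) \<partial>PiM J (\<lambda>_. M)) =
        (\<Prod>v\<in>S. \<integral>\<^sup>+b. f v a b \<partial>M)"
      using inner[OF a] by simp
  qed
  also have "\<dots> \<le> (\<integral>\<^sup>+a. (\<Prod>v\<in>S. c v) \<partial>M)"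
    using le by (intro nn_integral_mono_AE) (auto elim!: eventually_mono intro!: prod_mono_ennreal)
  also have "\<dots> = (\<Prod>v\<in>S. c v)"
    by (simp add: M.emeasure_space_1)
  finally show ?thesis .
qed

section \<open>Tail of the weight distribution\<close>

lemma emeasure_weight_greaterThan_le:
  assumes "w0 > 0" "\<beta> > 1" "y > 0"
  shows "emeasure (weight_distribution \<beta> w0) {y<..} \<le> ennreal ((y / w0) powr (1 - \<beta>))"
proof -
  interpret real_distribution "weight_distribution \<beta> w0"
    using assms by (intro real_distribution_weight_distribution)
  have "prob {y<..} = 1 - cdf (weight_distribution \<beta> w0) y"
    using prob_compl[of "{..y}"] by (simp add: cdf_def Compl_eq_Diff_UNIV[symmetric])
  also have "\<dots> \<le> (y / w0) powr (1 - \<beta>)"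
  proof (cases "y < w0")
    case True
    \<comment> \<open>Below \<open>w0\<close> the claimed bound is at least 1, hence
      trivial.\<close>
    then have "(1::real) \<le> (w0 / y) powr (\<beta> - 1)"
      using assms by (intro ge_one_powr_ge_zero) auto
    also have "\<dots> = (y / w0) powr (1 - \<beta>)"
      using assms by (simp add: powr_def ln_div algebra_simps)
    finally show ?thesis
      using True assms by (simp add: cdf_weight_distribution weight_cdf_def)
  qed (use assms in \<open>simp add: cdf_weight_distribution weight_cdf_def\<close>)
  finally show ?thesis
    by (simp add: emeasure_eq_measure ennreal_leI)
qed

text \<open>The closed half-line lies in the open one starting at \<open>y / 2\<close>; halving the
  threshold costs only the constant factor \<open>2 powr (\<beta> - 1)\<close>.\<close>

lemma emeasure_weight_atLeast_le:
  assumes "w0 > 0" "\<beta> > 1" "y > 0"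
  shows "emeasure (weight_distribution \<beta> w0) {y..}
           \<le> ennreal ((1 / (2 * w0)) powr (1 - \<beta>) * y powr (1 - \<beta>))"
proof -
  have "emeasure (weight_distribution \<beta> w0) {y..} \<le> emeasure (weight_distribution \<beta> w0) {y / 2<..}"
    using assms by (intro emeasure_mono) auto
  also have "\<dots> \<le> ennreal ((y / 2 / w0) powr (1 - \<beta>))"
    using assms by (intro emeasure_weight_greaterThan_le) auto
  also have "y / 2 / w0 = 1 / (2 * w0) * y"
    by simp
  also have "\<dots> powr (1 - \<beta>) = (1 / (2 * w0)) powr (1 - \<beta>) * y powr (1 - \<beta>)"
    by (rule powr_mult)
  finally show ?thesis .
qed

text \<open>The distribution function vanishes at \<open>w0\<close>, so \<open>{..w0}\<close> is a
  null set. Positive weights keep the connection thresholds nonnegative.\<close>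

lemma AE_weight_greater:
  assumes "w0 > 0" "\<beta> > 1"
  shows "AE a in weight_distribution \<beta> w0. a > w0"
proof -
  interpret real_distribution "weight_distribution \<beta> w0"
    using assms by (intro real_distribution_weight_distribution)
  have "prob {..w0} = 0"
    using cdf_weight_distribution[OF assms] assms
    by (simp add: cdf_def fun_eq_iff weight_cdf_def)
  then have "{..w0} \<in> null_sets (weight_distribution \<beta> w0)"
    by (intro null_setsI) (auto simp: emeasure_eq_measure)
  from AE_not_in[OF this] show ?thesis
    by eventually_elim auto
qed

section \<open>Expected degree into vertices of larger weight\<close>

lemma term_le_suminf: "f k \<le> (\<Sum>k. f k)" for f :: "nat \<Rightarrow> ennreal"
  using sum_le_suminf[of f "{k}"] by simp

text \<open>Take the least \<open>m\<close> with \<open>b < 2 ^ m * a\<close>; it is positive since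
  \<open>a \<le> b\<close>, and \<open>k\<close> is its predecessor.\<close>

lemma dyadic_bracket:
  fixes a b :: real
  assumes "0 < a" "a \<le> b"
  obtains k where "2 ^ k * a \<le> b" "b \<le> 2 ^ Suc k * a"
proof -
  have "\<exists>m. b < 2 ^ m * a"
    using real_arch_pow[of 2 "b / a"] assms by (auto simp: field_simps)
  then obtain m where m: "b < 2 ^ m * a" "\<And>j. j < m \<Longrightarrow> \<not> b < 2 ^ j * a"
    using exists_least_iff[of "\<lambda>m. b < 2 ^ m * a"] by auto
  then obtain k where "m = Suc k"
    using assms by (cases m) auto
  then show thesis
    using m that[of k] by force
qed

text \<open>The expected degree of a vertex of weight \<open>a\<close> into the vertices of weight at least \<open>a\<close>
  grows like \<open>a\<close> to the power \<open>3 - \<beta>\<close> up to \<open>a = sqrt n\<close>; beyond that, the number of vertices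
  of weight at least \<open>a\<close> is already small enough.\<close>

lemma nn_integral_upward_connection_le:
  assumes "lam > 0" "w0 > 0" "\<beta> > 2" "\<beta> < 3"
  obtains C where "C > 0"
    "\<And>n a. n \<ge> 1 \<Longrightarrow> a > 0 \<Longrightarrow>
      (\<integral>\<^sup>+b. indicator {a..} b * ennreal (min 1 (lam * a * b / real n)) \<partial>weight_distribution \<beta> w0)
        \<le> ennreal (C * real n powr ((3 - \<beta>) / 2 - 1))"
proof -
  define T where "T = (1 / (2 * w0)) powr (1 - \<beta>)"
  \<comment> \<open>Ratio of the geometric series below: from one dyadic scale to the next the
    connection bound doubles while the tail bound shrinks by \<open>2 powr (1 - \<beta>)\<close>. It
    is below 1 because \<open>\<beta> > 2\<close>.\<close>
  define q where "q = (2::real) powr (2 - \<beta>)"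
  let ?W = "weight_distribution \<beta> w0"
  have T: "T > 0"
    using assms by (simp add: T_def)
  have "q < 2 powr 0"
    unfolding q_def using assms by (intro powr_less_mono) auto
  then have q: "0 < q" "q < 1"
    by (auto simp: q_def)
  \<comment> \<open>The first summand serves weights \<open>a\<close> from \<open>sqrt n\<close> on,
    the second, coming from the sum of the geometric series, serves smaller
    \<open>a\<close>.\<close>
  define C where "C = T + 2 * T * lam / (1 - q)"
  have C: "T \<le> C" "2 * T * lam / (1 - q) \<le> C"
    using T q assms by (auto simp: C_def)
  show thesis
  proof (rule that)
    show "C > 0"
      using C T by linarith
    fix n :: nat and a :: real
    assume n: "n \<ge> 1" and a: "a > 0"
    show "(\<integral>\<^sup>+b. indicator {a..} b * ennreal (min 1 (lam * a * b / real n)) \<partial>?W)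
        \<le> ennreal (C * real n powr ((3 - \<beta>) / 2 - 1))"
    proof (cases "a \<ge> real n powr (1/2)")
      case True
      have "(\<integral>\<^sup>+b. indicator {a..} b * ennreal (min 1 (lam * a * b / real n)) \<partial>?W)
          \<le> (\<integral>\<^sup>+b. indicator {a..} b \<partial>?W)"
        by (intro nn_integral_mono) (auto simp: indicator_def intro: ennreal_le_1[THEN iffD2])
      also have "\<dots> = emeasure ?W {a..}"
        by simp
      also have "\<dots> \<le> ennreal (T * a powr (1 - \<beta>))"
        unfolding T_def using assms a by (intro emeasure_weight_atLeast_le) auto
      also have "\<dots> \<le> ennreal (C * real n powr ((3 - \<beta>) / 2 - 1))"
      proof (intro ennreal_leI mult_mono)
        \<comment> \<open>The exponents match because
          \<open>(1 - \<beta>) / 2 = (3 - \<beta>) / 2 - 1\<close>.\<close>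
        have "a powr (1 - \<beta>) \<le> (real n powr (1/2)) powr (1 - \<beta>)"
          using True assms n by (intro powr_mono2') auto
        also have "\<dots> = real n powr ((3 - \<beta>) / 2 - 1)"
          by (simp add: powr_powr field_simps)
        finally show "a powr (1 - \<beta>) \<le> real n powr ((3 - \<beta>) / 2 - 1)" .
      qed (use C T in auto)
      finally show ?thesis .
    next
      case False
      \<comment> \<open>The linear connection bound at the upper end of the \<open>k\<close>-th
        dyadic layer.\<close>
      define h where "h k = lam * a * (2 ^ Suc k * a) / real n" for k
      have h: "h k \<ge> 0" for k
        using assms a by (simp add: h_def)
      \<comment> \<open>The half-lines overlap, but for an upper bound the single term of the layer
        containing \<open>b\<close> is enough.\<close>
      have "(\<integral>\<^sup>+b. indicator {a..} b * ennreal (min 1 (lam * a * b / real n)) \<partial>?W)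
          \<le> (\<integral>\<^sup>+b. (\<Sum>k. indicator {2 ^ k * a..} b * ennreal (h k)) \<partial>?W)"
      proof (rule nn_integral_mono)
        fix b :: real
        show "indicator {a..} b * ennreal (min 1 (lam * a * b / real n))
            \<le> (\<Sum>k. indicator {2 ^ k * a..} b * ennreal (h k))"
        proof (cases "a \<le> b")
          case True
          then obtain k where k: "2 ^ k * a \<le> b" "b \<le> 2 ^ Suc k * a"
            using dyadic_bracket[OF a] by blast
          have "lam * a * b / real n \<le> h k"
            unfolding h_def using k assms a by (intro divide_right_mono mult_left_mono) auto
          then have "indicator {a..} b * ennreal (min 1 (lam * a * b / real n))
              \<le> indicator {2 ^ k * a..} b * ennreal (h k)"
            using True k by (auto intro!: ennreal_leI)
          also have "\<dots> \<le> (\<Sum>k. indicator {2 ^ k * a..} b * ennreal (h k))"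
            by (rule term_le_suminf)
          finally show ?thesis .
        qed simp
      qed
      also have "\<dots> = (\<Sum>k. emeasure ?W {2 ^ k * a..} * ennreal (h k))"
      proof (subst nn_integral_suminf)
        show "(\<lambda>b. indicator {2 ^ k * a..} b * ennreal (h k)) \<in> borel_measurable ?W" for k
          by measurable
        have "(\<integral>\<^sup>+b. indicator {2 ^ k * a..} b * ennreal (h k) \<partial>?W) = emeasure ?W {2 ^ k * a..} * ennreal (h k)" for k
          by (subst nn_integral_multc) auto
        then show "(\<Sum>k. \<integral>\<^sup>+b. indicator {2 ^ k * a..} b * ennreal (h k) \<partial>?W) =
            (\<Sum>k. emeasure ?W {2 ^ k * a..} * ennreal (h k))"
          by simp
      qed
      also have "\<dots> \<le> (\<Sum>k. ennreal (2 * T * lam / real n * a powr (3 - \<beta>) * q ^ k))"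
      proof (intro suminf_le summableI)
        fix k
        have "emeasure ?W {2 ^ k * a..} * ennreal (h k)
            \<le> ennreal (T * (2 ^ k * a) powr (1 - \<beta>)) * ennreal (h k)"
          unfolding T_def using assms a by (intro mult_right_mono emeasure_weight_atLeast_le) auto
        also have "\<dots> = ennreal (T * (2 ^ k * a) powr (1 - \<beta>) * h k)"
          using h T by (intro ennreal_mult[symmetric]) auto
        also have "T * (2 ^ k * a) powr (1 - \<beta>) * h k
            = 2 * T * lam / real n * (a powr (1 - \<beta>) * a powr 2) * (2 ^ k * (2 ^ k) powr (1 - \<beta>))"
          using a by (simp add: h_def powr_mult power2_eq_square)
        also have "a powr (1 - \<beta>) * a powr 2 = a powr (3 - \<beta>)"
          unfolding powr_add[symmetric] by simp
        also have "2 ^ k * (2 ^ k) powr (1 - \<beta>) = q ^ k"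
          by (simp add: q_def powr_realpow[symmetric] powr_powr powr_add[symmetric] algebra_simps)
        finally show "emeasure ?W {2 ^ k * a..} * ennreal (h k)
            \<le> ennreal (2 * T * lam / real n * a powr (3 - \<beta>) * q ^ k)" .
      qed
      also have "\<dots> = ennreal (2 * T * lam / real n * a powr (3 - \<beta>) * (1 / (1 - q)))"
        using q T assms by (intro suminf_ennreal_eq sums_mult geometric_sums) auto
      also have "\<dots> \<le> ennreal (C * real n powr ((3 - \<beta>) / 2 - 1))"
      proof (rule ennreal_leI)
        have "a powr (3 - \<beta>) \<le> (real n powr (1/2)) powr (3 - \<beta>)"
          using False assms a by (intro powr_mono2) auto
        also have "\<dots> = real n powr ((3 - \<beta>) / 2)"
          by (simp add: powr_powr)
        finally have "a powr (3 - \<beta>) / real n \<le> real n powr ((3 - \<beta>) / 2 - 1)"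
          using n by (simp add: powr_diff[of "real n"] divide_right_mono)
        then have "2 * T * lam / (1 - q) * (a powr (3 - \<beta>) / real n)
            \<le> C * real n powr ((3 - \<beta>) / 2 - 1)"
          using C T q assms by (intro mult_mono) auto
        then show "2 * T * lam / real n * a powr (3 - \<beta>) * (1 / (1 - q))
            \<le> C * real n powr ((3 - \<beta>) / 2 - 1)"
          by (simp add: field_simps)
      qed
      finally show ?thesis .
    qed
  qed
qed

section \<open>Star events and their measurability\<close>

text \<open>The adjacency condition is spelled out instead of using \<open>girg_edges\<close>, so
  that the event is visibly a conjunction over \<open>v\<close> of conditions on the pair
  \<open>u\<close>, \<open>v\<close>. Ties in weight are allowed, which covers any choice of a
  vertex of minimal weight.\<close>

definition star_event ::
    "real \<Rightarrow> nat \<Rightarrow> nat \<Rightarrow> nat \<Rightarrow> nat set \<Rightarrow> (nat \<Rightarrow> real) \<times> (nat \<Rightarrow> nat \<Rightarrow> real) \<Rightarrow> bool" where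
  "star_event lam n d u S G \<longleftrightarrow> (\<forall>v\<in>S. fst G u \<le> fst G v \<and>
     torus_dist d (snd G u) (snd G v) \<le> 1 / 2 * (lam * fst G u * fst G v / real n) powr (1 / real d))"

lemma measurable_weight:
  "v < n \<Longrightarrow> (\<lambda>G. fst G v) \<in> borel_measurable (girg_measure n \<beta> w0 d)"
proof -
  assume "v < n"
  then have "(\<lambda>w. w v) \<in> measurable (PiM {..<n} (\<lambda>_. weight_distribution \<beta> w0)) (weight_distribution \<beta> w0)"
    by (intro measurable_component_singleton) simp
  then have "(\<lambda>w. w v) \<in> borel_measurable (PiM {..<n} (\<lambda>_. weight_distribution \<beta> w0))"
    by (simp cong: measurable_cong_sets)
  then show ?thesis
    unfolding girg_measure_def by (rule measurable_compose[OF measurable_fst])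
qed

lemma measurable_position:
  "v < n \<Longrightarrow> (\<lambda>G. snd G v) \<in> measurable (girg_measure n \<beta> w0 d) (torus_uniform d)"
  unfolding girg_measure_def
  by (rule measurable_compose[OF measurable_snd measurable_component_singleton]) simp

lemma pred_adjacent:
  assumes "d \<ge> 1" "u < n" "v < n"
  shows "Measurable.pred (girg_measure n \<beta> w0 d) (\<lambda>G. torus_dist d (snd G u) (snd G v)
           \<le> 1 / 2 * (lam * fst G u * fst G v / real n) powr (1 / real d))"
proof -
  note [measurable] = measurable_weight[OF assms(2)] measurable_weight[OF assms(3)]
  show ?thesis
    using assms by (intro pred_torus_dist_le measurable_position) measurable
qed

lemma pred_star_event:
  assumes "d \<ge> 1" "u < n" "S \<subseteq> {..<n}"
  shows "Measurable.pred (girg_measure n \<beta> w0 d) (star_event lam n d u S)"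
  unfolding star_event_def
proof (intro pred_intros_finite pred_intros_logic)
  show "finite S"
    using assms finite_subset by blast
  fix v assume "v \<in> S"
  then have v: "v < n"
    using assms by auto
  note [measurable] = measurable_weight[OF assms(2)] measurable_weight[OF v]
  show "Measurable.pred (girg_measure n \<beta> w0 d) (\<lambda>G. fst G u \<le> fst G v)"
    by measurable
  show "Measurable.pred (girg_measure n \<beta> w0 d) (\<lambda>G. torus_dist d (snd G u) (snd G v)
           \<le> 1 / 2 * (lam * fst G u * fst G v / real n) powr (1 / real d))"
    by (rule pred_adjacent[OF assms(1,2) v])
qed

lemma pred_clique:
  assumes "d \<ge> 1" "K \<subseteq> {..<n}"
  shows "Measurable.pred (girg_measure n \<beta> w0 d) (\<lambda>G. clique K (girg_edges lam n d G))"
proof -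
  have fin: "finite K"
    using assms finite_subset by blast
  let ?adj = "\<lambda>G u v. torus_dist d (snd G u) (snd G v)
    \<le> 1 / 2 * (lam * fst G u * fst G v / real n) powr (1 / real d)"
  have edge: "{u, v} \<in> girg_edges lam n d G \<longleftrightarrow> u \<noteq> v \<and> ?adj G u v" if "u \<in> K" "v \<in> K" for u v G
    using that assms(2) doubleton_in_girg_edges_iff[of u v lam n d "fst G" "snd G"] by auto
  have eq: "(\<lambda>G. clique K (girg_edges lam n d G)) = (\<lambda>G. \<forall>u\<in>K. \<forall>v\<in>K. u \<noteq> v \<longrightarrow> ?adj G u v)"
    unfolding clique_def by (intro ext ball_cong refl) (simp add: edge)
  show ?thesis
    unfolding eq
  proof (intro pred_intros_finite fin pred_intros_imp')
    fix u v assume "u \<in> K" "v \<in> K"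
    then show "Measurable.pred (girg_measure n \<beta> w0 d) (\<lambda>G. ?adj G u v)"
      using assms by (intro pred_adjacent) auto
  qed
qed

section \<open>Probability of a star event\<close>

text \<open>This is the estimate for fixed weights, whose thresholds are the numbers
  \<open>t v\<close>. The indicator of the event is a product of indicators over \<open>S\<close>,
  so \<open>nn_integral_PiM_star_le\<close> reduces it to volumes of single balls.\<close>

lemma emeasure_positions_star_le:
  fixes n u :: nat
  assumes d: "d \<ge> 1" and u: "u < n" and S: "S \<subseteq> {..<n} - {u}" and t: "\<And>v. v \<in> S \<Longrightarrow> t v \<ge> 0"
  shows "emeasure (PiM {..<n} (\<lambda>_. torus_uniform d))
      {x \<in> space (PiM {..<n} (\<lambda>_. torus_uniform d)).
        \<forall>v\<in>S. torus_dist d (x u) (x v) \<le> 1 / 2 * t v powr (1 / real d)}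
    \<le> (\<Prod>v\<in>S. ennreal (min 1 (t v)))"
proof -
  let ?P = "PiM {..<n} (\<lambda>_. torus_uniform d)"
  define r where "r v = 1 / 2 * t v powr (1 / real d)" for v
  let ?B = "\<lambda>v a b. torus_dist d a b \<le> r v"
  let ?E = "{x \<in> space ?P. \<forall>v\<in>S. ?B v (x u) (x v)}"
  have fin: "finite S"
    using finite_subset[OF S] by simp
  have "Measurable.pred ?P (\<lambda>x. \<forall>v\<in>S. ?B v (x u) (x v))"
    using u S d by (intro pred_intros_finite fin pred_torus_dist_le measurable_component_singleton) auto
  then have E: "?E \<in> sets ?P"
    by (rule predE)
  have B: "Measurable.pred (torus_uniform d \<Otimes>\<^sub>M torus_uniform d) (\<lambda>p. ?B v (fst p) (snd p))" for v
    using d by (intro pred_torus_dist_le) auto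
  have "emeasure ?P ?E = (\<integral>\<^sup>+x. indicator ?E x \<partial>?P)"
    using E by simp
  also have "\<dots> = (\<integral>\<^sup>+x. (\<Prod>v\<in>S. indicator {p. ?B v (fst p) (snd p)} (x u, x v)) \<partial>?P)"
  proof (rule nn_integral_cong)
    fix x assume x: "x \<in> space ?P"
    show "indicator ?E x = (\<Prod>v\<in>S. indicator {p. ?B v (fst p) (snd p)} (x u, x v) :: ennreal)"
    proof (cases "\<forall>v\<in>S. ?B v (x u) (x v)")
      case True
      then show ?thesis
        using x by simp
    next
      case False
      then have "(\<Prod>v\<in>S. indicator {p. ?B v (fst p) (snd p)} (x u, x v) :: ennreal) = 0"
        using fin by (intro prod_zero) (auto simp: indicator_def)
      then show ?thesis
        using False by (simp add: indicator_def)
    qed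
  qed
  also have "\<dots> \<le> (\<Prod>v\<in>S. ennreal (min 1 (t v)))"
  proof (rule nn_integral_PiM_star_le)
    show "case_prod (\<lambda>a b. indicator {p. ?B v (fst p) (snd p)} (a, b) :: ennreal)
        \<in> borel_measurable (torus_uniform d \<Otimes>\<^sub>M torus_uniform d)" for v
      using B[of v] by (simp add: borel_measurable_indicator_iff pred_def Int_def conj_commute)
    show "AE a in torus_uniform d. \<forall>v\<in>S.
        (\<integral>\<^sup>+b. indicator {p. ?B v (fst p) (snd p)} (a, b) \<partial>torus_uniform d) \<le> ennreal (min 1 (t v))"
      using AE_torus_uniform AE_space
    proof eventually_elim
      case (elim a)
      show ?case
      proof
        fix v assume v: "v \<in> S"
        have "Measurable.pred (torus_uniform d) (?B v a)"
          using d elim(2) by (intro pred_torus_dist_le) auto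
        then have "{b \<in> space (torus_uniform d). ?B v a b} \<in> sets (torus_uniform d)"
          by (rule predE)
        then have "(\<integral>\<^sup>+b. indicator {p. ?B v (fst p) (snd p)} (a, b) \<partial>torus_uniform d) =
            emeasure (torus_uniform d) {b \<in> space (torus_uniform d). ?B v a b}"
          by (subst nn_integral_indicator[symmetric], assumption)
            (rule nn_integral_cong, simp add: indicator_def)
        also have "\<dots> \<le> ennreal (min 1 (t v))"
          unfolding r_def by (rule emeasure_torus_ball_le[OF d elim(1)[rule_format] t[OF v]])
        finally show "(\<integral>\<^sup>+b. indicator {p. ?B v (fst p) (snd p)} (a, b) \<partial>torus_uniform d)
            \<le> ennreal (min 1 (t v))" .
      qed
    qed
  qed (use u S prob_space_torus_uniform in auto)
  finally show ?thesis
    by (simp only: r_def)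
qed

text \<open>Fubini integrates over the positions first, leaving a product over \<open>S\<close> of
  functions of \<open>w u\<close> and \<open>w v\<close>. This has the star form again, so
  \<open>nn_integral_PiM_star_le\<close> applies a second time, now to the weights.\<close>

lemma emeasure_star_event_le:
  assumes par: "lam > 0" "w0 > 0" "\<beta> > 1" and d: "d \<ge> 1" and u: "u < n" and S: "S \<subseteq> {..<n} - {u}"
    and Q: "\<And>a. a > 0 \<Longrightarrow>
      (\<integral>\<^sup>+b. indicator {a..} b * ennreal (min 1 (lam * a * b / real n)) \<partial>weight_distribution \<beta> w0) \<le> Q"
  shows "emeasure (girg_measure n \<beta> w0 d) {G \<in> space (girg_measure n \<beta> w0 d). star_event lam n d u S G}
    \<le> Q ^ card S"
proof -
  let ?W = "weight_distribution \<beta> w0"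
  let ?PW = "PiM {..<n} (\<lambda>_. ?W)" and ?PX = "PiM {..<n} (\<lambda>_. torus_uniform d)"
  let ?G = "girg_measure n \<beta> w0 d"
  let ?E = "{G \<in> space ?G. star_event lam n d u S G}"
  let ?f = "\<lambda>a b. indicator {a..} b * ennreal (min 1 (lam * a * b / real n))"
  have fin: "finite S"
    using finite_subset[OF S] by simp
  interpret W: real_distribution ?W
    using par by (intro real_distribution_weight_distribution)
  interpret X: prob_space ?PX
    by (intro prob_space_PiM prob_space_torus_uniform)
  have "Measurable.pred ?G (star_event lam n d u S)"
    using S d u by (intro pred_star_event) auto
  then have "?E \<in> sets (?PW \<Otimes>\<^sub>M ?PX)"
    by (simp add: girg_measure_def)
  then have "emeasure ?G ?E = (\<integral>\<^sup>+w. emeasure ?PX (Pair w -` ?E) \<partial>?PW)"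
    unfolding girg_measure_def by (rule X.emeasure_pair_measure_alt)
  also have "\<dots> \<le> (\<integral>\<^sup>+w. (\<Prod>v\<in>S. ?f (w u) (w v)) \<partial>?PW)"
  proof (rule nn_integral_mono_AE)
    \<comment> \<open>Positive weights give the nonnegative thresholds required by
      \<open>emeasure_positions_star_le\<close>.\<close>
    have "AE w in ?PW. \<forall>v\<in>{..<n}. w v > w0"
      using par by (intro AE_finite_allI AE_PiM_component AE_weight_greater W.prob_space_axioms) auto
    then show "AE w in ?PW. emeasure ?PX (Pair w -` ?E) \<le> (\<Prod>v\<in>S. ?f (w u) (w v))"
      using AE_space
    proof eventually_elim
      case (elim w)
      have pos: "w v > 0" if "v < n" for v
        using elim(1)[rule_format, of v] that par by simp
      show ?case
      proof (cases "\<forall>v\<in>S. w u \<le> w v")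
        case True
        have "Pair w -` ?E = {x \<in> space ?PX. \<forall>v\<in>S. torus_dist d (x u) (x v)
            \<le> 1 / 2 * (lam * w u * w v / real n) powr (1 / real d)}"
          using True elim(2) by (auto simp: girg_measure_def space_pair_measure star_event_def)
        also have "emeasure ?PX \<dots> \<le> (\<Prod>v\<in>S. ennreal (min 1 (lam * w u * w v / real n)))"
        proof (rule emeasure_positions_star_le[OF d u S])
          fix v assume "v \<in> S"
          then have "v < n"
            using S by auto
          then show "0 \<le> lam * w u * w v / real n"
            using pos[OF u] pos[of v] par by simp
        qed
        also have "\<dots> = (\<Prod>v\<in>S. ?f (w u) (w v))"
          using True by (intro prod.cong) auto
        finally show ?thesis .
      next
        case False
        then have "Pair w -` ?E = {}"
          by (auto simp: star_event_def)
        then show ?thesis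
          by (simp only: emeasure_empty zero_le)
      qed
    qed
  qed
  also have "\<dots> \<le> (\<Prod>v\<in>S. Q)"
  proof (rule nn_integral_PiM_star_le[where f = "\<lambda>_. ?f"])
    have [measurable]: "(\<lambda>(a, b). indicator {a..} b :: ennreal) \<in> borel_measurable (borel \<Otimes>\<^sub>M (borel :: real measure))"
    proof -
      have "(\<lambda>p :: real \<times> real. if fst p \<le> snd p then 1 else 0 :: ennreal) \<in> borel_measurable (borel \<Otimes>\<^sub>M borel)"
        by measurable
      also have "(\<lambda>p :: real \<times> real. if fst p \<le> snd p then 1 else 0 :: ennreal) = (\<lambda>(a, b). indicator {a..} b)"
        by (auto simp: indicator_def)
      finally show ?thesis .
    qed
    show "case_prod ?f \<in> borel_measurable (?W \<Otimes>\<^sub>M ?W)"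
      by measurable
    show "AE a in ?W. \<forall>v\<in>S. (\<integral>\<^sup>+b. ?f a b \<partial>?W) \<le> Q"
      using AE_weight_greater[OF par(2,3)] by eventually_elim (use Q par in auto)
  qed (use u S W.prob_space_axioms in auto)
  also have "\<dots> = Q ^ card S"
    by simp
  finally show ?thesis .
qed

section \<open>From large cliques to star events, and the union bound\<close>

text \<open>The centre \<open>u\<close> is a vertex of \<open>K\<close> of minimal weight. The
  strict inequality \<open>card K > k\<close> pays for \<open>u\<close> itself, so \<open>k\<close>
  further vertices remain.\<close>

lemma clique_imp_star_event:
  assumes "K \<subseteq> {..<n}" "clique K (girg_edges lam n d G)" "card K > k"
  obtains u S where "u < n" "S \<subseteq> {..<n} - {u}" "card S = k" "star_event lam n d u S G"
proof -
  have fin: "finite K" "K \<noteq> {}"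
    using assms finite_subset by fastforce+
  then obtain u where u: "u \<in> K" "\<And>v. v \<in> K \<Longrightarrow> fst G u \<le> fst G v"
    by (metis arg_min_if_finite(1) arg_min_least)
  have "k \<le> card (K - {u})"
    using assms(3) u fin by simp
  then obtain S where S: "S \<subseteq> K - {u}" "card S = k"
    by (meson obtain_subset_with_card_n)
  have "star_event lam n d u S G"
    unfolding star_event_def
  proof (intro ballI conjI)
    fix v assume "v \<in> S"
    then have v: "v \<in> K" "v \<noteq> u"
      using S by auto
    then show "fst G u \<le> fst G v"
      using u by blast
    have "{u, v} \<in> girg_edges lam n d (fst G, snd G)"
      using assms(2) u v by (auto simp: clique_def)
    then show "torus_dist d (snd G u) (snd G v)
        \<le> 1 / 2 * (lam * fst G u * fst G v / real n) powr (1 / real d)"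
      unfolding doubleton_in_girg_edges_iff by blast
  qed
  then show thesis
    using that[of u S] u S assms(1) by auto
qed

text \<open>Bound the binomial coefficient by \<open>n ^ k / k!\<close>. With
  \<open>y = exp 1 * n * q\<close> the product becomes \<open>y ^ k / k!\<close> times
  \<open>exp (- k)\<close>, and \<open>y ^ k / k!\<close> is a single term of the series of
  \<open>exp y\<close>.\<close>

lemma binomial_mult_power_le_exp:
  fixes q :: real
  assumes "q \<ge> 0"
  shows "real (n choose k) * q ^ k \<le> exp (exp 1 * real n * q - real k)"
proof -
  let ?y = "exp 1 * real n * q"
  have "real (n choose k) * fact k \<le> real n ^ k"
    using binomial_fact_pow[of n k] by (metis of_nat_fact of_nat_le_iff of_nat_mult of_nat_power)
  then have "real (n choose k) \<le> real n ^ k / fact k"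
    by (simp add: field_simps)
  then have "real (n choose k) * q ^ k \<le> real n ^ k / fact k * q ^ k"
    using assms by (intro mult_right_mono) auto
  also have "\<dots> = ?y ^ k / fact k * exp (- real k)"
    by (simp add: power_mult_distrib exp_minus exp_of_nat_mult[of k 1, simplified] field_simps)
  also have "?y ^ k / fact k \<le> exp ?y"
  proof -
    have s: "(\<lambda>j. ?y ^ j / fact j) sums exp ?y"
      using exp_converges[of ?y] by (simp add: divide_inverse mult.commute)
    then show ?thesis
      using sum_le_suminf[OF sums_summable[OF s], of "{k}"] assms by (simp add: sums_unique[OF s])
  qed
  finally show ?thesis
    by (simp add: exp_diff exp_minus field_simps)
qed

text \<open>An explicit bound for each fixed \<open>n\<close>; asymptotics enter only when
  \<open>c\<close> and \<open>q\<close> are chosen as functions of \<open>n\<close>.\<close>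

lemma prob_large_clique_le:
  assumes par: "lam > 0" "w0 > 0" "\<beta> > 1" and d: "d \<ge> 1" and c: "c \<ge> 0" and q: "q \<ge> 0"
    and Q: "\<And>a. a > 0 \<Longrightarrow>
      (\<integral>\<^sup>+b. indicator {a..} b * ennreal (min 1 (lam * a * b / real n)) \<partial>weight_distribution \<beta> w0)
        \<le> ennreal q"
  shows "1 - \<P>(G in girg_measure n \<beta> w0 d. real (clique_number {..<n} (girg_edges lam n d G)) \<le> c)
    \<le> real n * exp (exp 1 * real n * q + 1 - c)"
proof -
  let ?M = "girg_measure n \<beta> w0 d"
  interpret prob_space ?M
    using par by (intro prob_space_girg_measure) auto
  \<comment> \<open>A clique of size above \<open>c\<close> has more than \<open>k\<close> vertices.
    Rounding loses less than 1, which accounts for the \<open>+ 1\<close> in the exponent.\<close>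
  define k where "k = nat \<lfloor>c\<rfloor>"
  define P where "P G \<longleftrightarrow> real (clique_number {..<n} (girg_edges lam n d G)) \<le> c" for G
  define \<S> where "\<S> u = {S. S \<subseteq> {..<n} - {u} \<and> card S = k}" for u
  define A where "A u S = {G \<in> space ?M. star_event lam n d u S G}" for u S
  have fin: "finite (\<S> u)" for u
    by (rule finite_subset[of _ "Pow {..<n}"]) (auto simp: \<S>_def)
  have A_sets: "A u S \<in> events" if "u < n" "S \<in> \<S> u" for u S
  proof -
    have "S \<subseteq> {..<n}"
      using that(2) by (auto simp: \<S>_def)
    then have "Measurable.pred ?M (star_event lam n d u S)"
      by (rule pred_star_event[OF d that(1)])
    then show ?thesis
      by (simp add: A_def)
  qed
  \<comment> \<open>Measurability justifies passing to the complement.\<close>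
  have "Measurable.pred ?M P"
    unfolding P_def clique_number_le_iff[OF finite_lessThan]
    using d by (intro pred_intros_finite pred_intros_logic pred_clique) auto
  then have meas: "{G \<in> space ?M. P G} \<in> events"
    by simp
  have "1 - prob {G \<in> space ?M. P G} = prob (space ?M - {G \<in> space ?M. P G})"
    using prob_compl[OF meas] by simp
  also have "\<dots> \<le> prob (\<Union>u<n. \<Union>S\<in>\<S> u. A u S)"
  proof (rule finite_measure_mono)
    show "(\<Union>u<n. \<Union>S\<in>\<S> u. A u S) \<in> events"
      using A_sets fin by (intro sets.finite_UN) auto
    show "space ?M - {G \<in> space ?M. P G} \<subseteq> (\<Union>u<n. \<Union>S\<in>\<S> u. A u S)"
    proof
      fix G assume G: "G \<in> space ?M - {G \<in> space ?M. P G}"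
      then obtain K where K: "K \<subseteq> {..<n}" "clique K (girg_edges lam n d G)" "real (card K) > c"
        unfolding P_def clique_number_le_iff[OF finite_lessThan] by (auto simp: not_le)
      have "card K > k"
        using K(3) c unfolding k_def by linarith
      from clique_imp_star_event[OF K(1,2) this] G show "G \<in> (\<Union>u<n. \<Union>S\<in>\<S> u. A u S)"
        by (fastforce simp: A_def \<S>_def)
    qed
  qed
  also have "\<dots> \<le> (\<Sum>u<n. prob (\<Union>S\<in>\<S> u. A u S))"
    using A_sets fin by (intro finite_measure_subadditive_finite) auto
  also have "\<dots> \<le> (\<Sum>u<n. \<Sum>S\<in>\<S> u. prob (A u S))"
    using A_sets fin by (intro sum_mono finite_measure_subadditive_finite) auto
  also have "\<dots> \<le> (\<Sum>u<n. \<Sum>S\<in>\<S> u. q ^ k)"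
  proof (intro sum_mono)
    fix u S assume uS: "u \<in> {..<n}" "S \<in> \<S> u"
    then have "emeasure ?M (A u S) \<le> ennreal q ^ card S"
      unfolding A_def by (intro emeasure_star_event_le[OF par d]) (auto simp: \<S>_def intro: Q)
    also have "\<dots> = ennreal (q ^ k)"
      using uS q by (simp add: \<S>_def ennreal_power)
    finally show "prob (A u S) \<le> q ^ k"
      using q by (simp add: emeasure_eq_measure)
  qed
  also have "\<dots> = (\<Sum>u<n. real (n - 1 choose k) * q ^ k)"
    by (intro sum.cong refl) (simp add: \<S>_def n_subsets)
  also have "\<dots> \<le> (\<Sum>u<n. exp (exp 1 * real n * q + 1 - c))"
  proof (rule sum_mono)
    have "real (n - 1 choose k) * q ^ k \<le> real (n choose k) * q ^ k"
      using q by (intro mult_right_mono of_nat_mono binomial_right_mono) auto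
    also have "\<dots> \<le> exp (exp 1 * real n * q - real k)"
      by (rule binomial_mult_power_le_exp[OF q])
    also have "\<dots> \<le> exp (exp 1 * real n * q + 1 - c)"
      using c unfolding k_def by simp linarith
    finally show "real (n - 1 choose k) * q ^ k \<le> exp (exp 1 * real n * q + 1 - c)" .
  qed
  also have "\<dots> = real n * exp (exp 1 * real n * q + 1 - c)"
    by simp
  finally show ?thesis
    by (simp add: P_def)
qed

section \<open>Choice of the constant and passage to the limit\<close>

theorem theorem15:
  fixes lam w0 \<beta> :: real and d :: "nat \<Rightarrow> nat"
  assumes "lam > 0" and "w0 > 0" and "\<beta> > 2" and "\<beta> < 3"
    and "\<And>n. d n \<ge> 1"
  shows "\<exists>C>0. (\<lambda>n. \<P>(G in girg_measure n \<beta> w0 (d n).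
            real (clique_number {..<n} (girg_edges lam n (d n) G)) \<le> C * real n powr ((3 - \<beta>) / 2)))
          \<longlonglongrightarrow> 1"
proof -
  define g where "g = (3 - \<beta>) / 2"
  have g: "g > 0"
    using assms by (simp add: g_def)
  obtain C0 where C0: "C0 > 0"
    "\<And>n a. n \<ge> 1 \<Longrightarrow> a > 0 \<Longrightarrow>
      (\<integral>\<^sup>+b. indicator {a..} b * ennreal (min 1 (lam * a * b / real n)) \<partial>weight_distribution \<beta> w0)
        \<le> ennreal (C0 * real n powr (g - 1))"
    unfolding g_def using nn_integral_upward_connection_le[OF assms(1-4)] by blast
  \<comment> \<open>Since \<open>n * n powr (g - 1) = n powr g\<close>, the summand
    \<open>exp 1 * C0\<close> cancels the growing term of the exponent, and the extra 1 leaves the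
    decay \<open>exp (- (n powr g))\<close>.\<close>
  define C where "C = exp 1 * C0 + 1"
  have C: "C > 0"
    using C0 by (simp add: C_def add_pos_pos)
  define p where "p n = \<P>(G in girg_measure n \<beta> w0 (d n).
            real (clique_number {..<n} (girg_edges lam n (d n) G)) \<le> C * real n powr g)" for n
  have lower: "1 - real n * exp (1 - real n powr g) \<le> p n" if n: "n \<ge> 1" for n
  proof -
    have "1 - p n \<le> real n * exp (exp 1 * real n * (C0 * real n powr (g - 1)) + 1 - C * real n powr g)"
      unfolding p_def using assms C C0 n by (intro prob_large_clique_le) auto
    also have "exp 1 * real n * (C0 * real n powr (g - 1)) + 1 - C * real n powr g = 1 - real n powr g"
      using n by (simp add: C_def powr_diff field_simps)
    finally show ?thesis
      by linarith
  qed
  have upper: "p n \<le> 1" for n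
    unfolding p_def using assms by (intro prob_space.prob_le_1 prob_space_girg_measure) auto
  \<comment> \<open>As \<open>g > 0\<close>, which is where \<open>\<beta> < 3\<close> enters here,
    the stretched exponential beats the factor \<open>n\<close> from the choice of the
    centre.\<close>
  have "(\<lambda>n. 1 - real n * exp (1 - real n powr g)) \<longlonglongrightarrow> 1"
    using g by real_asymp
  then have "p \<longlonglongrightarrow> 1"
    by (rule tendsto_sandwich[OF _ _ _ tendsto_const, rotated 2])
      (use lower upper in \<open>auto intro: eventually_sequentiallyI[of 1]\<close>)
  then show ?thesis
    using C unfolding p_def g_def by blast
qed

end
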